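(* Let $A$ and $B$ be strings of the same length over $\{\mathrm{H},\mathrm{T}\}$. If $A$ starts with $\mathrm{HH}$ and $B$ starts with $\mathrm{TT}$, or vice versa ($A$ starts with $\mathrm{TT}$ and $B$ starts with $\mathrm{HH}$), then the No-Flippancy game with Alice's string $A$ and Bob's string $B$ is infinite.
   Context: No-Flippancy game: Alice and Bob have distinct strings $A=A_1\cdots A_n$ and $B=B_1\cdots B_n$ of the same length $n$ over the alphabet $\{\mathrm{H},\mathrm{T}\}$. Starting from the empty sequence, the players alternate turns, Alice going first, and on each turn the current player appends one letter to the sequence (the game output) as follows: let $i<n$ be the maximal length of a suffix of the current sequence that coincides with a prefix of the current player's string ($i=0$ is allowed, via the empty suffix); the player appends the letter with index $i+1$ of their own string. The game ends as soon as $A$ or $B$ appears as a block of consecutive letters in the sequence (necessarily as its suffix, no matter who made the last move); the player whose string appears first wins. If neither string ever appears, the game is infinite. *)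

theory Defs
  imports Main "HOL-Library.Sublist"
begin

datatype letter = H | T

(* The largest i < length P such that the prefix of P of length i is a suffix of s. *)
definition match_length :: "letter list \<Rightarrow> letter list \<Rightarrow> nat" where
  "match_length P s = Max {i. i < length P \<and> suffix (take i P) s}"

(* Since ! counts from 0, this is the letter with 1-based index match_length P s + 1. *)
definition next_letter :: "letter list \<Rightarrow> letter list \<Rightarrow> letter" where
  "next_letter P s = P ! match_length P s"

definition game_over :: "letter list \<Rightarrow> letter list \<Rightarrow> letter list \<Rightarrow> bool" where
  "game_over A B s \<longleftrightarrow> sublist A s \<or> sublist B s"

(* The sequence after k turns (constant from the end of the game on, if it ends).
   Turns are counted from 0, so Alice (string A) makes the even ones. *)
primrec play :: "letter list \<Rightarrow> letter list \<Rightarrow> nat \<Rightarrow> letter list" where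
  "play A B 0 = []"
| "play A B (Suc k) =
    (let s = play A B k in
     if game_over A B s then s
     else s @ [next_letter (if even k then A else B) s])"

definition game_infinite :: "letter list \<Rightarrow> letter list \<Rightarrow> bool" where
  "game_infinite A B \<longleftrightarrow> (\<forall>k. \<not> game_over A B (play A B k))"

end

theory Submission imports Defs begin

text \<open>As long as the output alternates between the two initial letters, no prefix of length at
  least 2 of the current player's string occurs in it, and the output does not end in that player's
  initial letter. So the match has length 0, the player appends their initial letter, and the
  output keeps alternating.\<close>

lemma next_letter_no_match:
  assumes "prefix [x, x] P" "\<not> sublist [x, x] s" "\<not> suffix [x] s"
  shows "next_letter P s = x"
proof -
  obtain Q where P: "P = x # x # Q"
    using assms(1) by (auto simp: prefix_def)
  have "i = 0" if "suffix (take i P) s" for i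
  proof (rule ccontr)
    assume "i \<noteq> 0"
    \<comment> \<open>A match of length 1 would be the suffix \<open>[x]\<close>; a longer one would
      start with \<open>[x, x]\<close>.\<close>
    then consider "i = 1" | j where "i = Suc (Suc j)"
      by (metis One_nat_def not0_implies_Suc)
    then show False
    proof cases
      case 1
      with that assms(3) show False by (simp add: P)
    next
      case (2 j)
      have "sublist [x, x] (take i P)"
        by (simp add: 2 P prefix_imp_sublist)
      with that assms(2) show False
        by (meson sublist_order.order_trans suffix_imp_sublist)
    qed
  qed
  then have "{i. i < length P \<and> suffix (take i P) s} = {0}"
    by (auto simp: P)
  then show ?thesis
    by (simp add: next_letter_def match_length_def P)
qed

text \<open>Keeping \<open>x\<close> and \<open>y\<close> arbitrary covers both assignments of H and
  T to the players.\<close>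

lemma game_infinite_if_distinct_double_starts:
  assumes A: "prefix [x, x] A" and B: "prefix [y, y] B" and "x \<noteq> y"
  shows "game_infinite A B"
proof -
  have not_over: "\<not> game_over A B s" if "\<not> sublist [x, x] s" "\<not> sublist [y, y] s" for s
    using that A B unfolding game_over_def
    by (meson prefix_imp_sublist sublist_order.order_trans)
  \<comment> \<open>The third conjunct, on the letter of the player to move, makes the invariant
    inductive.\<close>
  have "\<not> sublist [x, x] (play A B k) \<and> \<not> sublist [y, y] (play A B k) \<and>
        \<not> suffix [if even k then x else y] (play A B k)" for k
  proof (induction k)
    case 0
    then show ?case by simp
  next
    case (Suc k)
    define s where "s = play A B k"
    have s: "\<not> sublist [x, x] s" "\<not> sublist [y, y] s" "\<not> suffix [if even k then x else y] s"
      using Suc.IH by (simp_all add: s_def)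
    have "next_letter (if even k then A else B) s = (if even k then x else y)"
      using next_letter_no_match[OF A] next_letter_no_match[OF B] s by (cases "even k") simp_all
    then have "play A B (Suc k) = s @ [if even k then x else y]"
      using not_over[OF s(1,2)] by (simp add: s_def[symmetric])
    \<comment> \<open>A new double letter could only arise at the end, by repeating the last letter
      of \<open>s\<close>; the third conjunct rules this out. As \<open>x \<noteq> y\<close>, the
      output then does not end in the next player's letter.\<close>
    moreover have "suffix [u, u] (s @ [v]) \<longleftrightarrow> u = v \<and> suffix [u] s" for u v
      using suffix_snoc[of "[u, u]" s v] by auto
    ultimately show ?case
      using s \<open>x \<noteq> y\<close> by (auto simp: sublist_snoc)
  qed
  then show ?thesis
    using not_over by (simp add: game_infinite_def)
qed

theorem corollary15:
  fixes A B :: "letter list"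
  assumes "length A = length B"
    and "prefix [H, H] A \<and> prefix [T, T] B \<or> prefix [T, T] A \<and> prefix [H, H] B"
  shows "game_infinite A B"
  using assms(2) game_infinite_if_distinct_double_starts by blast

end
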